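(* Let $\mathcal{X}\subseteq\mathbb{Z}^n$ be a discrete hyperrectangle and let $h^i:\mathcal{X}\to\mathbb{R}$, $i\in N=\{1,\dots,n\}$. Let $H(\mathbf{x},\mathbf{y})=\max_{i\in N}\{h^i(\mathbf{x})-y_i\}$ for $(\mathbf{x},\mathbf{y})\in\mathcal{X}\times\mathbb{R}^n_+$, with epigraph $$\mathcal{P}^H=\{(w,\mathbf{y},\mathbf{x})\in\mathbb{R}\times\mathbb{R}^n_+\times\mathcal{X}: w\ge h^i(\mathbf{x})-y_i\ \forall i\in N\}.$$ Assume that for all $i,j\in N$ the functions $h^j$ and $g^j_i(\mathbf{x}):=\max\{0,h^i(\mathbf{x})-h^j(\mathbf{x})\}$ are L$^\natural$-convex on $\mathcal{X}$. Then $$\operatorname{conv}(\mathcal{P}^H)=\{(w,\mathbf{y},\mathbf{x})\in\mathbb{R}^{n+1}\times\overline{\mathcal{X}}: (u_0w+\mathbf{u}^\top\mathbf{y},\mathbf{x})\in\operatorname{conv}(\mathcal{P}^{F_{u_0,\mathbf{u}}})\ \ \forall (u_0,\mathbf{u})\in\mathcal{U}\},$$ where $\mathcal{U}=\{(u_0,\mathbf{u})\in\mathbb{R}^{n+1}_+:u_0\le\sum_{i\in N}u_i\}$ and, for $(u_0,\mathbf{u})\in\mathcal{U}$, $$F_{u_0,\mathbf{u}}(\mathbf{x})=\min_{j\in N}\Big\{u_0h^j(\mathbf{x})+\sum_{i\in N}u_i\,g^j_i(\mathbf{x})\Big\},\qquad \mathbf{x}\in\mathcal{X}.$$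
   Context: A discrete hyperrectangle is $\mathcal{X}=\{\mathbf{x}\in\mathbb{Z}^n:\ell_i\le x_i\le u_i\ \forall i\in N\}$ with bounds $\ell_i\in\mathbb{Z}\cup\{-\infty\}$, $u_i\in\mathbb{Z}\cup\{+\infty\}$ (these upper bounds are unrelated to the multiplier vector $\mathbf{u}$ in $\mathcal{U}$); $\overline{\mathcal{X}}\subseteq\mathbb{R}^n$ is its continuous relaxation (same bounds, integrality dropped). $f:\mathcal{X}\to\mathbb{R}$ is L$^\natural$-convex if $f(\mathbf{x})+f(\mathbf{y})\ge f(\lceil(\mathbf{x}+\mathbf{y})/2\rceil)+f(\lfloor(\mathbf{x}+\mathbf{y})/2\rfloor)$ for all $\mathbf{x},\mathbf{y}\in\mathcal{X}$ (component-wise rounding). For $F:\mathcal{X}\to\mathbb{R}$, $\mathcal{P}^F=\{(\eta,\mathbf{x})\in\mathbb{R}\times\mathcal{X}:\eta\ge F(\mathbf{x})\}$. *)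

theory Defs
  imports "HOL-Analysis.Analysis"
begin

text \<open>
  The index set \<open>N\<close> is a finite type \<open>'n\<close> (nonempty, as every type), and \<open>\<int>\<^sup>n\<close> is the set of
  points of \<open>real ^ 'n\<close> with integer coordinates. Functions \<open>X \<rightarrow> \<real>\<close> are total functions on
  \<open>real ^ 'n\<close> of which only the values on \<open>X\<close> are ever used.
\<close>

definition hyperrectangle_bounds :: "('n::finite \<Rightarrow> ereal) \<Rightarrow> ('n \<Rightarrow> ereal) \<Rightarrow> bool" where
  "hyperrectangle_bounds lb ub \<longleftrightarrow>
     (\<forall>i. (lb i = -\<infinity> \<or> (\<exists>k::int. lb i = ereal (of_int k))) \<and>
          (ub i = \<infinity> \<or> (\<exists>k::int. ub i = ereal (of_int k))))"

definition relaxed_hyperrectangle ::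
    "('n::finite \<Rightarrow> ereal) \<Rightarrow> ('n \<Rightarrow> ereal) \<Rightarrow> (real ^ 'n) set" where
  "relaxed_hyperrectangle lb ub = {x. \<forall>i. lb i \<le> ereal (x $ i) \<and> ereal (x $ i) \<le> ub i}"

definition discrete_hyperrectangle ::
    "('n::finite \<Rightarrow> ereal) \<Rightarrow> ('n \<Rightarrow> ereal) \<Rightarrow> (real ^ 'n) set" where
  "discrete_hyperrectangle lb ub =
     {x. \<forall>i. x $ i \<in> \<int> \<and> lb i \<le> ereal (x $ i) \<and> ereal (x $ i) \<le> ub i}"

definition vec_ceiling :: "real ^ 'n::finite \<Rightarrow> real ^ 'n" where
  "vec_ceiling x = (\<chi> i. of_int \<lceil>x $ i\<rceil>)"

definition vec_floor :: "real ^ 'n::finite \<Rightarrow> real ^ 'n" where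
  "vec_floor x = (\<chi> i. of_int \<lfloor>x $ i\<rfloor>)"

definition L_natural_convex_on :: "(real ^ 'n::finite) set \<Rightarrow> (real ^ 'n \<Rightarrow> real) \<Rightarrow> bool" where
  "L_natural_convex_on X f \<longleftrightarrow>
     (\<forall>x\<in>X. \<forall>y\<in>X. f x + f y \<ge> f (vec_ceiling ((x + y) /\<^sub>R 2)) + f (vec_floor ((x + y) /\<^sub>R 2)))"

text \<open>The set \<open>P\<^sup>F\<close> for \<open>F : X \<rightarrow> \<real>\<close>.\<close>

definition epi_on :: "(real ^ 'n::finite) set \<Rightarrow> (real ^ 'n \<Rightarrow> real) \<Rightarrow> (real \<times> (real ^ 'n)) set" where
  "epi_on X F = {(\<eta>, x). x \<in> X \<and> \<eta> \<ge> F x}"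

definition H_fun :: "('n::finite \<Rightarrow> real ^ 'n \<Rightarrow> real) \<Rightarrow> real ^ 'n \<Rightarrow> real ^ 'n \<Rightarrow> real" where
  "H_fun h x y = Max (range (\<lambda>i. h i x - y $ i))"

text \<open>The epigraph \<open>P\<^sup>H\<close> of \<open>H\<close>, with coordinates ordered \<open>(w, y, x)\<close>.\<close>

definition epi_H ::
    "(real ^ 'n::finite) set \<Rightarrow> ('n \<Rightarrow> real ^ 'n \<Rightarrow> real) \<Rightarrow> (real \<times> (real ^ 'n) \<times> (real ^ 'n)) set" where
  "epi_H X h = {(w, y, x). (\<forall>i. 0 \<le> y $ i) \<and> x \<in> X \<and> (\<forall>i. w \<ge> h i x - y $ i)}"

lemma epi_H_eq: "epi_H X h = {(w, y, x). (\<forall>i. 0 \<le> y $ i) \<and> x \<in> X \<and> w \<ge> H_fun h x y}"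
  by (auto simp: epi_H_def H_fun_def)

text \<open>\<open>g_fun h j i\<close> is \<open>g\<^sup>j\<^sub>i\<close>, the superscript coming first.\<close>

definition g_fun ::
    "('n::finite \<Rightarrow> real ^ 'n \<Rightarrow> real) \<Rightarrow> 'n \<Rightarrow> 'n \<Rightarrow> real ^ 'n \<Rightarrow> real" where
  "g_fun h j i x = max 0 (h i x - h j x)"

definition multipliers :: "(real \<times> (real ^ 'n::finite)) set" where
  "multipliers = {(u0, u). 0 \<le> u0 \<and> (\<forall>i. 0 \<le> u $ i) \<and> u0 \<le> (\<Sum>i\<in>UNIV. u $ i)}"

definition F_fun ::
    "('n::finite \<Rightarrow> real ^ 'n \<Rightarrow> real) \<Rightarrow> real \<Rightarrow> real ^ 'n \<Rightarrow> real ^ 'n \<Rightarrow> real" where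
  "F_fun h u0 u x = Min (range (\<lambda>j. u0 * h j x + (\<Sum>i\<in>UNIV. u $ i * g_fun h j i x)))"

end

theory Submission
  imports Defs
begin

text \<open>
  Minimising \<open>u\<^sub>0 w + u \<bullet> y\<close> over the fibre of \<open>P\<^sup>H\<close> above \<open>x\<close> gives \<open>F x\<close>, and linear programming
  duality turns this into \<open>F x = max {v \<bullet> h x | 0 \<le> v \<le> u, \<Sum> v = u\<^sub>0}\<close>. An exchange argument between
  two optimal \<open>v\<close> shows that \<open>F\<close> is \<open>L\<^sup>\<natural>\<close>-convex. For such functions a point of the convex hull of the
  epigraph above \<open>x\<close> only needs lattice points at distance at most one from \<open>x\<close>, hence a finite set
  that does not depend on the multipliers. Above this finite set the hull of \<open>P\<^sup>H\<close> has closed slices,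
  and a point outside a slice is separated from it by a linear functional that is bounded below on
  the recession cone, that is, by a multiplier in \<open>\<U>\<close>.
\<close>

section \<open>Linear programming duality for \<open>F_fun\<close>\<close>

lemma F_fun_le: "F_fun h u0 u x \<le> u0 * h j x + (\<Sum>i\<in>UNIV. u $ i * g_fun h j i x)"
  unfolding F_fun_def by (rule Min_le) auto

lemma F_fun_attained:
  obtains j where "F_fun h u0 u x = u0 * h j x + (\<Sum>i\<in>UNIV. u $ i * g_fun h j i x)"
proof -
  have "F_fun h u0 u x \<in> range (\<lambda>j. u0 * h j x + (\<Sum>i\<in>UNIV. u $ i * g_fun h j i x))"
    unfolding F_fun_def by (rule Min_in) auto
  then show thesis using that by blast
qed

text \<open>Weak duality: \<open>0 \<le> v i\<close> and \<open>v i \<le> u $ i\<close> bound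
  \<open>v i * (h i x - h j x)\<close> by \<open>u $ i * g_fun h j i x\<close>, and in the sum over
  \<open>i\<close> the terms with \<open>h j x\<close> add up to \<open>u0 * h j x\<close>.\<close>

lemma weights_le_F_fun:
  fixes h :: "'n::finite \<Rightarrow> real ^ 'n \<Rightarrow> real"
  assumes v: "\<And>i. 0 \<le> v i" "\<And>i. v i \<le> u $ i" "sum v UNIV = u0"
  shows "(\<Sum>i\<in>UNIV. v i * h i x) \<le> F_fun h u0 u x"
proof -
  obtain j where j: "F_fun h u0 u x = u0 * h j x + (\<Sum>i\<in>UNIV. u $ i * g_fun h j i x)"
    by (rule F_fun_attained)
  have "v i * (h i x - h j x) \<le> u $ i * g_fun h j i x" for i
  proof -
    have "v i * (h i x - h j x) \<le> v i * g_fun h j i x"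
      by (intro mult_left_mono v) (simp add: g_fun_def)
    also have "\<dots> \<le> u $ i * g_fun h j i x"
      by (intro mult_right_mono v) (simp add: g_fun_def)
    finally show ?thesis .
  qed
  then have "(\<Sum>i\<in>UNIV. v i * (h i x - h j x)) \<le> (\<Sum>i\<in>UNIV. u $ i * g_fun h j i x)"
    by (intro sum_mono)
  moreover have "(\<Sum>i\<in>UNIV. v i * (h i x - h j x)) = (\<Sum>i\<in>UNIV. v i * h i x) - u0 * h j x"
    by (simp add: v(3)[symmetric] right_diff_distrib sum_subtractf sum_distrib_right)
  ultimately show ?thesis using j by linarith
qed

text \<open>The weights are filled greedily from the largest \<open>h i x\<close> downwards until they sum to \<open>u\<^sub>0\<close>; the
  index \<open>j\<close> at which this stops attains the minimum defining \<open>F\<close>.\<close>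

lemma F_fun_weights:
  fixes h :: "'n::finite \<Rightarrow> real ^ 'n \<Rightarrow> real"
  assumes "(u0, u) \<in> multipliers"
  obtains v where "\<And>i. 0 \<le> v i" "\<And>i. v i \<le> u $ i" "sum v UNIV = u0"
    "F_fun h u0 u x = (\<Sum>i\<in>UNIV. v i * h i x)"
proof -
  have u0: "0 \<le> u0" and u: "\<And>i. 0 \<le> u $ i" and u0_le: "u0 \<le> (\<Sum>i\<in>UNIV. u $ i)"
    using assms by (auto simp: multipliers_def)
  \<comment> \<open>\<open>J\<close> holds the indices whose upper level set carries capacity at
    least \<open>u0\<close>. An index of least value belongs to it, and \<open>j\<close> is one of
    largest value in it.\<close>
  define J where "J = {j. u0 \<le> (\<Sum>i | h j x \<le> h i x. u $ i)}"
  obtain j0 where "\<And>i. h j0 x \<le> h i x"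
    using ex_min_if_finite[of "range (\<lambda>i. h i x)"] by (auto simp: not_less)
  then have "j0 \<in> J" using u0_le by (simp add: J_def)
  then have "Max ((\<lambda>i. h i x) ` J) \<in> (\<lambda>i. h i x) ` J" by (intro Max_in) auto
  then obtain j where j: "j \<in> J" and j_eq: "Max ((\<lambda>i. h i x) ` J) = h j x" by auto
  have jmax: "h k x \<le> h j x" if "k \<in> J" for k
    unfolding j_eq[symmetric] using that by (intro Max_ge) auto
  define a b where "a = (\<Sum>i | h j x < h i x. u $ i)" and "b = (\<Sum>i | h i x = h j x. u $ i)"
  have "{i. h j x \<le> h i x} = {i. h j x < h i x} \<union> {i. h i x = h j x}" by auto
  then have "(\<Sum>i | h j x \<le> h i x. u $ i) = a + b"
    unfolding a_def b_def by (subst sum.union_disjoint[symmetric]) auto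
  then have ab: "u0 \<le> a + b" using j by (simp add: J_def)
  \<comment> \<open>The next larger value \<open>h k x\<close> has as upper level set the indices
    strictly above \<open>h j x\<close>, and the choice of \<open>j\<close> keeps \<open>k\<close>
    out of \<open>J\<close>.\<close>
  have a: "a \<le> u0"
  proof (cases "\<exists>k. h j x < h k x")
    case True
    then have "Min ((\<lambda>i. h i x) ` {i. h j x < h i x}) \<in> (\<lambda>i. h i x) ` {i. h j x < h i x}"
      by (intro Min_in) auto
    then obtain k where k: "h j x < h k x"
      and k_eq: "Min ((\<lambda>i. h i x) ` {i. h j x < h i x}) = h k x" by auto
    have kmin: "h k x \<le> h i x" if "h j x < h i x" for i
      unfolding k_eq[symmetric] using that by (intro Min_le) auto
    have "{i. h k x \<le> h i x} = {i. h j x < h i x}" using k kmin by force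
    moreover have "k \<notin> J" using jmax[of k] k by auto
    ultimately show ?thesis by (simp add: J_def a_def)
  next
    case False
    then show ?thesis using u0 by (simp add: a_def)
  qed
  have b0: "0 \<le> b" unfolding b_def by (intro sum_nonneg u)
  \<comment> \<open>The fraction of the level \<open>h j x\<close> that gets filled. If
    \<open>b = 0\<close>, division by zero yields \<open>0\<close>, which is right because then
    \<open>a = u0\<close>.\<close>
  define \<theta> where "\<theta> = (u0 - a) / b"
  have \<theta>: "0 \<le> \<theta>" "\<theta> \<le> 1" using a ab b0 by (auto simp: \<theta>_def divide_le_eq_1)
  have \<theta>b: "\<theta> * b = u0 - a" using a ab by (auto simp: \<theta>_def)
  define v where "v i = (if h j x < h i x then u $ i else 0) + \<theta> * (if h i x = h j x then u $ i else 0)" for i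
  have v: "0 \<le> v i" "v i \<le> u $ i" for i
    using u[of i] \<theta> by (auto simp: v_def mult_left_le_one_le)
  have sv: "sum v UNIV = u0"
  proof -
    have "sum v UNIV = a + \<theta> * b"
      unfolding v_def a_def b_def
      by (simp add: sum.distrib sum_distrib_left[symmetric] sum.inter_filter[symmetric])
    then show ?thesis using \<theta>b by simp
  qed
  \<comment> \<open>Complementary slackness: above the level \<open>v i = u $ i\<close>; on it both
    sides vanish because \<open>h i x = h j x\<close>; below it both \<open>g_fun h j i x\<close>
    and \<open>v i\<close> are zero.\<close>
  have "u $ i * g_fun h j i x = v i * (h i x - h j x)" for i
    by (auto simp: g_fun_def v_def)
  then have "u0 * h j x + (\<Sum>i\<in>UNIV. u $ i * g_fun h j i x) = (\<Sum>i\<in>UNIV. v i * h i x)"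
    by (simp add: sv[symmetric] right_diff_distrib sum_subtractf sum_distrib_right)
  then have "F_fun h u0 u x = (\<Sum>i\<in>UNIV. v i * h i x)"
    using F_fun_le[of h u0 u x j] weights_le_F_fun[of v u u0 h x] v sv by auto
  then show thesis using that v sv by blast
qed

section \<open>Closure properties and the exchange argument for \<open>F_fun\<close>\<close>

lemma L_natural_convex_onD:
  assumes "L_natural_convex_on X f" "x \<in> X" "y \<in> X"
  shows "f (vec_ceiling ((x + y) /\<^sub>R 2)) + f (vec_floor ((x + y) /\<^sub>R 2)) \<le> f x + f y"
  using assms by (auto simp: L_natural_convex_on_def)

lemma L_natural_convex_on_add:
  assumes "L_natural_convex_on X f" "L_natural_convex_on X g"
  shows "L_natural_convex_on X (\<lambda>x. f x + g x)"
  unfolding L_natural_convex_on_def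
proof (intro ballI)
  fix x y assume "x \<in> X" "y \<in> X"
  then show "f (vec_ceiling ((x + y) /\<^sub>R 2)) + g (vec_ceiling ((x + y) /\<^sub>R 2)) +
      (f (vec_floor ((x + y) /\<^sub>R 2)) + g (vec_floor ((x + y) /\<^sub>R 2))) \<le> f x + g x + (f y + g y)"
    using assms[THEN L_natural_convex_onD, of x y] by linarith
qed

lemma L_natural_convex_on_cmult:
  assumes "L_natural_convex_on X f" "0 \<le> c"
  shows "L_natural_convex_on X (\<lambda>x. c * f x)"
  using assms by (auto simp: L_natural_convex_on_def distrib_left[symmetric] mult_left_mono)

lemma L_natural_convex_on_sum:
  assumes "finite I" "\<And>i. i \<in> I \<Longrightarrow> L_natural_convex_on X (f i)"
  shows "L_natural_convex_on X (\<lambda>x. \<Sum>i\<in>I. f i x)"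
  using assms
proof (induction I rule: finite_induct)
  case empty
  then show ?case by (simp add: L_natural_convex_on_def)
next
  case (insert i I)
  then show ?case by (simp add: L_natural_convex_on_add)
qed

text \<open>For optimal weights \<open>v\<close>, \<open>v'\<close> at the two rounded midpoints, transport the excess of \<open>v\<close> over \<open>v'\<close>
  to that of \<open>v'\<close> over \<open>v\<close> by a plan \<open>t\<close>. With \<open>c = min v v'\<close>, the function
  \<open>G = \<Sum> c i h i + \<Sum> t i j max (h i) (h j)\<close> is \<open>L\<^sup>\<natural>\<close>-convex, lies below \<open>F\<close> and dominates both values.\<close>

lemma L_natural_convex_on_F_fun:
  fixes h :: "'n::finite \<Rightarrow> real ^ 'n \<Rightarrow> real"
  assumes h: "\<And>j. L_natural_convex_on X (h j)"
    and g: "\<And>i j. L_natural_convex_on X (g_fun h j i)"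
    and u: "(u0, u) \<in> multipliers"
  shows "L_natural_convex_on X (F_fun h u0 u)"
  unfolding L_natural_convex_on_def
proof (intro ballI)
  fix x y assume "x \<in> X" "y \<in> X"
  define xc xf where "xc = vec_ceiling ((x + y) /\<^sub>R 2)" and "xf = vec_floor ((x + y) /\<^sub>R 2)"
  obtain v where v: "\<And>i. 0 \<le> v i" "\<And>i. v i \<le> u $ i" "sum v UNIV = u0"
    "F_fun h u0 u xc = (\<Sum>i\<in>UNIV. v i * h i xc)"
    by (rule F_fun_weights[OF u, where h = h and x = xc], rule that)
  obtain v' where v': "\<And>i. 0 \<le> v' i" "\<And>i. v' i \<le> u $ i" "sum v' UNIV = u0"
    "F_fun h u0 u xf = (\<Sum>i\<in>UNIV. v' i * h i xf)"
    by (rule F_fun_weights[OF u, where h = h and x = xf], rule that)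
  define c p q where "c i = min (v i) (v' i)" and "p i = v i - c i" and "q i = v' i - c i" for i
  define s where "s = sum p UNIV"
  have nonneg: "0 \<le> c i" "0 \<le> p i" "0 \<le> q i" for i
    using v(1)[of i] v'(1)[of i] by (auto simp: c_def p_def q_def)
  \<comment> \<open>The left-hand side is the larger of \<open>v i\<close> and
    \<open>v' i\<close>.\<close>
  have cpq: "c i + p i + q i \<le> u $ i" for i
    using v(2)[of i] v'(2)[of i] by (auto simp: c_def p_def q_def)
  have s: "sum p UNIV = s" "sum q UNIV = s"
    using v(3) v'(3) by (auto simp: s_def p_def q_def sum_subtractf)
  have s0: "0 \<le> s" unfolding s_def by (intro sum_nonneg nonneg)
  define t where "t i j = p i * q j / s" for i j \<comment> \<open>zero when \<open>s = 0\<close>\<close>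
  have t0: "0 \<le> t i j" for i j using nonneg s0 by (simp add: t_def)
  have tp: "(\<Sum>j\<in>UNIV. t i j) = p i" for i
  proof (cases "s = 0")
    case True
    then have "p i = 0" using s(1) nonneg(2) by (simp add: sum_nonneg_eq_0_iff)
    then show ?thesis by (simp add: t_def)
  next
    case False
    then show ?thesis
      by (simp add: t_def sum_distrib_left[symmetric] sum_divide_distrib[symmetric] s)
  qed
  have tq: "(\<Sum>i\<in>UNIV. t i j) = q j" for j
  proof (cases "s = 0")
    case True
    then have "q j = 0" using s(2) nonneg(3) by (simp add: sum_nonneg_eq_0_iff)
    then show ?thesis by (simp add: t_def)
  next
    case False
    then show ?thesis
      by (simp add: t_def sum_distrib_right[symmetric] sum_divide_distrib[symmetric] s)
  qed
  have tp': "(\<Sum>i\<in>UNIV. \<Sum>j\<in>UNIV. t i j * a i) = (\<Sum>i\<in>UNIV. p i * a i)" for a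
    by (simp add: sum_distrib_right[symmetric] tp)
  have tq': "(\<Sum>i\<in>UNIV. \<Sum>j\<in>UNIV. t i j * a j) = (\<Sum>j\<in>UNIV. q j * a j)" for a
    by (subst sum.swap) (simp add: sum_distrib_right[symmetric] tq)
  \<comment> \<open>The maximum of \<open>h i z\<close> and \<open>h j z\<close> is written as
    \<open>h j z + g_fun h j i z\<close>, a sum of two functions that are L-natural-convex by
    assumption.\<close>
  define G where "G z = (\<Sum>i\<in>UNIV. c i * h i z) +
    (\<Sum>i\<in>UNIV. \<Sum>j\<in>UNIV. t i j * (h j z + g_fun h j i z))" for z
  have G: "L_natural_convex_on X G"
    unfolding G_def using h g nonneg t0
    by (intro L_natural_convex_on_add L_natural_convex_on_sum L_natural_convex_on_cmult) auto
  have "F_fun h u0 u xc = (\<Sum>i\<in>UNIV. c i * h i xc) + (\<Sum>i\<in>UNIV. p i * h i xc)"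
    unfolding v(4) by (simp add: p_def sum.distrib[symmetric] algebra_simps)
  also have "\<dots> \<le> G xc"
    unfolding G_def tp'[symmetric]
    by (intro add_left_mono sum_mono mult_left_mono t0) (auto simp: g_fun_def)
  finally have Fc: "F_fun h u0 u xc \<le> G xc" .
  have "F_fun h u0 u xf = (\<Sum>i\<in>UNIV. c i * h i xf) + (\<Sum>i\<in>UNIV. q i * h i xf)"
    unfolding v'(4) by (simp add: q_def sum.distrib[symmetric] algebra_simps)
  also have "\<dots> \<le> G xf"
    unfolding G_def tq'[symmetric]
    by (intro add_left_mono sum_mono mult_left_mono t0) (auto simp: g_fun_def)
  finally have Ff: "F_fun h u0 u xf \<le> G xf" .
  have GF: "G z \<le> F_fun h u0 u z" for z
  proof -
    obtain m where m: "F_fun h u0 u z = u0 * h m z + (\<Sum>i\<in>UNIV. u $ i * g_fun h m i z)"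
      by (rule F_fun_attained)
    have sums: "u0 = (\<Sum>i\<in>UNIV. c i) + (\<Sum>i\<in>UNIV. p i)"
      using v(3) by (simp add: p_def sum_subtractf)
    \<comment> \<open>Everything is charged to the index \<open>m\<close>. Summed over the plan, the
      marginals \<open>p\<close> and \<open>q\<close> give \<open>g_fun h m i z\<close> the
      coefficient \<open>c i + p i + q i\<close>, which \<open>cpq\<close> bounds by
      \<open>u $ i\<close>.\<close>
    have "h i z \<le> h m z + g_fun h m i z"
      "h j z + g_fun h j i z \<le> h m z + g_fun h m i z + g_fun h m j z" for i j
      by (auto simp: g_fun_def)
    then have "G z \<le> (\<Sum>i\<in>UNIV. c i * (h m z + g_fun h m i z)) +
        (\<Sum>i\<in>UNIV. \<Sum>j\<in>UNIV. t i j * (h m z + g_fun h m i z + g_fun h m j z))"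
      unfolding G_def by (intro add_mono[OF sum_mono sum_mono] sum_mono mult_left_mono nonneg t0)
    also have "\<dots> = u0 * h m z + (\<Sum>i\<in>UNIV. (c i + p i + q i) * g_fun h m i z)"
      by (simp add: distrib_left distrib_right sum.distrib sums tp' tq' sum_distrib_right)
    also have "\<dots> \<le> F_fun h u0 u z"
      unfolding m by (intro add_left_mono sum_mono mult_right_mono cpq) (auto simp: g_fun_def)
    finally show ?thesis .
  qed
  show "F_fun h u0 u xc + F_fun h u0 u xf \<le> F_fun h u0 u x + F_fun h u0 u y"
    using L_natural_convex_onD[OF G \<open>x \<in> X\<close> \<open>y \<in> X\<close>] Fc Ff GF[of x] GF[of y]
    unfolding xc_def xf_def by linarith
qed

section \<open>Rounded midpoints and local convex hulls of epigraphs\<close>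

text \<open>What replacing a pair of points by its rounded midpoints needs of a domain. Cutting the
  domain down to a bounded, hence finite, set preserves it.\<close>

definition midpoint_closed :: "(real ^ 'n::finite) set \<Rightarrow> bool" where
  "midpoint_closed Y \<longleftrightarrow>
     (\<forall>x\<in>Y. \<forall>i. x $ i \<in> \<int>) \<and>
     (\<forall>x\<in>Y. \<forall>y\<in>Y. vec_ceiling ((x + y) /\<^sub>R 2) \<in> Y \<and> vec_floor ((x + y) /\<^sub>R 2) \<in> Y)"

text \<open>Parity decides: if \<open>k + l = 2 * m\<close>, both roundings are \<open>m\<close>;
  otherwise they are \<open>m + 1\<close> and \<open>m\<close>, and both lie between
  \<open>k\<close> and \<open>l\<close> because an odd sum forces these to differ.\<close>

lemma Ints_midpoint:
  fixes a b :: real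
  assumes "a \<in> \<int>" "b \<in> \<int>"
  defines "c \<equiv> of_int \<lceil>(a + b) / 2\<rceil>" and "d \<equiv> of_int \<lfloor>(a + b) / 2\<rfloor>"
  shows "c + d = a + b" "min a b \<le> d" "d \<le> c" "c \<le> max a b" "c - d \<le> 1"
proof -
  obtain k l where kl: "a = of_int k" "b = of_int l" using assms(1,2) by (auto elim!: Ints_cases)
  define m where "m = (k + l) div 2"
  consider "k + l = 2 * m" | "k + l = 2 * m + 1" unfolding m_def by linarith
  then have *: "c + d = a + b \<and> min a b \<le> d \<and> d \<le> c \<and> c \<le> max a b \<and> c - d \<le> 1"
  proof cases
    case 1
    then have ab: "a + b = 2 * of_int m" unfolding kl by (metis of_int_add of_int_mult of_int_numeral)
    then have "c = of_int m" "d = of_int m" by (simp_all add: c_def d_def)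
    then show ?thesis using ab by (auto simp: min_def max_def)
  next
    case 2
    then have ab: "a + b = 2 * of_int m + 1"
      unfolding kl by (metis of_int_1 of_int_add of_int_mult of_int_numeral)
    have "\<lceil>(a + b) / 2\<rceil> = m + 1" "\<lfloor>(a + b) / 2\<rfloor> = m"
      unfolding ab by (simp_all add: ceiling_eq_iff floor_eq_iff)
    then have "c = of_int (m + 1)" "d = of_int m" by (simp_all only: c_def d_def)
    moreover have "min k l \<le> m" "m + 1 \<le> max k l" using 2 by auto
    then have "real_of_int (min k l) \<le> of_int m" "real_of_int (m + 1) \<le> of_int (max k l)"
      by (simp_all only: of_int_le_iff)
    ultimately show ?thesis using ab by (simp add: kl of_int_min of_int_max)
  qed
  then show "c + d = a + b" "min a b \<le> d" "d \<le> c" "c \<le> max a b" "c - d \<le> 1" by auto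
qed

lemma midpoint_nth:
  "vec_ceiling ((x + y) /\<^sub>R 2) $ i = of_int \<lceil>(x $ i + y $ i) / 2\<rceil>"
  "vec_floor ((x + y) /\<^sub>R 2) $ i = of_int \<lfloor>(x $ i + y $ i) / 2\<rfloor>"
  by (simp_all add: vec_ceiling_def vec_floor_def field_simps)

lemma midpoint_closed_discrete_hyperrectangle:
  "midpoint_closed (discrete_hyperrectangle lb ub)"
  unfolding midpoint_closed_def
proof (intro conjI ballI allI)
  fix x y assume xy: "x \<in> discrete_hyperrectangle lb ub" "y \<in> discrete_hyperrectangle lb ub"
  have *: "lb i \<le> ereal t \<and> ereal t \<le> ub i"
    if "min (x $ i) (y $ i) \<le> t" "t \<le> max (x $ i) (y $ i)" for i t
  proof
    have "lb i \<le> ereal (min (x $ i) (y $ i))" "ereal (max (x $ i) (y $ i)) \<le> ub i"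
      using xy by (auto simp: discrete_hyperrectangle_def min_def max_def)
    then show "lb i \<le> ereal t" "ereal t \<le> ub i"
      using that by (meson ereal_less_eq(3) order_trans)+
  qed
  have int: "x $ i \<in> \<int>" "y $ i \<in> \<int>" for i using xy by (auto simp: discrete_hyperrectangle_def)
  note mid = Ints_midpoint[OF int]
  show "vec_ceiling ((x + y) /\<^sub>R 2) \<in> discrete_hyperrectangle lb ub"
    unfolding discrete_hyperrectangle_def midpoint_nth mem_Collect_eq
    by (intro allI conjI *[THEN conjunct1] *[THEN conjunct2] Ints_of_int order_trans[OF mid(2,3)] mid)
  show "vec_floor ((x + y) /\<^sub>R 2) \<in> discrete_hyperrectangle lb ub"
    unfolding discrete_hyperrectangle_def midpoint_nth mem_Collect_eq
    by (intro allI conjI *[THEN conjunct1] *[THEN conjunct2] Ints_of_int order_trans[OF mid(3,4)] mid)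
qed (auto simp: discrete_hyperrectangle_def)

lemma midpoint_closed_Int_box:
  assumes "midpoint_closed Y"
  shows "midpoint_closed {x \<in> Y. \<forall>i. \<bar>x $ i\<bar> \<le> M}"
  unfolding midpoint_closed_def
proof (intro conjI ballI allI)
  fix x y assume xy: "x \<in> {x \<in> Y. \<forall>i. \<bar>x $ i\<bar> \<le> M}" "y \<in> {x \<in> Y. \<forall>i. \<bar>x $ i\<bar> \<le> M}"
  then have int: "x $ i \<in> \<int>" "y $ i \<in> \<int>" for i using assms by (auto simp: midpoint_closed_def)
  have M: "\<bar>x $ i\<bar> \<le> M" "\<bar>y $ i\<bar> \<le> M" for i using xy by auto
  have "\<bar>vec_ceiling ((x + y) /\<^sub>R 2) $ i\<bar> \<le> M" "\<bar>vec_floor ((x + y) /\<^sub>R 2) $ i\<bar> \<le> M" for i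
  proof -
    have "- M \<le> min (x $ i) (y $ i)" "max (x $ i) (y $ i) \<le> M" using M[of i] by auto
    then show "\<bar>vec_ceiling ((x + y) /\<^sub>R 2) $ i\<bar> \<le> M" "\<bar>vec_floor ((x + y) /\<^sub>R 2) $ i\<bar> \<le> M"
      unfolding midpoint_nth abs_le_iff using Ints_midpoint(2-4)[OF int, of i i] by linarith+
  qed
  then show "vec_ceiling ((x + y) /\<^sub>R 2) \<in> {x \<in> Y. \<forall>i. \<bar>x $ i\<bar> \<le> M}"
    "vec_floor ((x + y) /\<^sub>R 2) \<in> {x \<in> Y. \<forall>i. \<bar>x $ i\<bar> \<le> M}"
    using assms xy by (auto simp: midpoint_closed_def)
qed (use assms in \<open>auto simp: midpoint_closed_def\<close>)

lemma finite_bounded_Ints_vec: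
  fixes Y :: "(real ^ 'n::finite) set"
  assumes "\<And>x i. x \<in> Y \<Longrightarrow> x $ i \<in> \<int>" "\<And>x i. x \<in> Y \<Longrightarrow> \<bar>x $ i\<bar> \<le> M"
  shows "finite Y"
proof -
  have "x \<in> (\<lambda>f. \<chi> i. real_of_int (f i)) ` (UNIV \<rightarrow> {-\<lceil>M\<rceil>..\<lceil>M\<rceil>})" if "x \<in> Y" for x
  proof
    have *: "real_of_int \<lfloor>x $ i\<rfloor> = x $ i" for i using assms(1)[OF that, of i] by simp
    show "x = (\<chi> i. real_of_int \<lfloor>x $ i\<rfloor>)" by (simp add: vec_eq_iff *)
    have "\<bar>real_of_int \<lfloor>x $ i\<rfloor>\<bar> \<le> of_int \<lceil>M\<rceil>" for i
      unfolding * using assms(2)[OF that, of i] by linarith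
    then have "\<bar>\<lfloor>x $ i\<rfloor>\<bar> \<le> \<lceil>M\<rceil>" for i by (metis of_int_abs of_int_le_iff)
    then show "(\<lambda>i. \<lfloor>x $ i\<rfloor>) \<in> UNIV \<rightarrow> {-\<lceil>M\<rceil>..\<lceil>M\<rceil>}" by (auto simp: abs_le_iff minus_le_iff)
  qed
  moreover have "finite (UNIV \<rightarrow> {-\<lceil>M\<rceil>..\<lceil>M\<rceil>} :: ('n \<Rightarrow> int) set)"
    using finite_PiE[of "UNIV :: 'n set" "\<lambda>_. {-\<lceil>M\<rceil>..\<lceil>M\<rceil>}"] by (simp add: PiE_UNIV_domain)
  ultimately show ?thesis by (meson finite_imageI finite_subset subsetI)
qed

text \<open>The identity \<open>sq\<close> expresses a sum of squares through the sum and the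
  difference. Rounding keeps the sum of two coordinates, never enlarges their distance, and at
  \<open>k\<close> reduces it from above one to at most one.\<close>

lemma inner_midpoint_less:
  fixes x y :: "real ^ 'n::finite"
  assumes "\<And>i. x $ i \<in> \<int>" "\<And>i. y $ i \<in> \<int>" and far: "1 < \<bar>x $ k - y $ k\<bar>"
  defines "p \<equiv> vec_ceiling ((x + y) /\<^sub>R 2)" and "q \<equiv> vec_floor ((x + y) /\<^sub>R 2)"
  shows "p \<bullet> p + q \<bullet> q < x \<bullet> x + y \<bullet> y"
proof -
  have sq: "2 * (a * a + b * b) = (a + b)\<^sup>2 + (a - b)\<^sup>2" for a b :: real
    by (simp add: power2_eq_square algebra_simps)
  have pq: "p $ i + q $ i = x $ i + y $ i" "\<bar>p $ i - q $ i\<bar> \<le> \<bar>x $ i - y $ i\<bar>" "\<bar>p $ i - q $ i\<bar> \<le> 1" for i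
    using Ints_midpoint[OF assms(1,2), of i i] unfolding p_def q_def midpoint_nth by auto
  have le: "p $ i * p $ i + q $ i * q $ i \<le> x $ i * x $ i + y $ i * y $ i" for i
    using sq[of "p $ i" "q $ i"] sq[of "x $ i" "y $ i"] pq(1)[of i] pq(2)[of i]
    by (simp add: abs_le_square_iff)
  have "\<bar>p $ k - q $ k\<bar> < \<bar>x $ k - y $ k\<bar>" using far pq(3)[of k] by linarith
  then have "(p $ k - q $ k)\<^sup>2 < (x $ k - y $ k)\<^sup>2"
    by (metis abs_ge_zero power2_abs power_strict_mono zero_less_numeral)
  then have less: "p $ k * p $ k + q $ k * q $ k < x $ k * x $ k + y $ k * y $ k"
    using sq[of "p $ k" "q $ k"] sq[of "x $ k" "y $ k"] pq(1)[of k] by simp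
  show ?thesis
    unfolding inner_vec_def inner_real_def sum.distrib[symmetric]
    by (rule sum_strict_mono_ex1) (use le less in auto)
qed

lemma midpoint_add:
  fixes x y :: "real ^ 'n::finite"
  assumes "\<And>i. x $ i \<in> \<int>" "\<And>i. y $ i \<in> \<int>"
  shows "vec_ceiling ((x + y) /\<^sub>R 2) + vec_floor ((x + y) /\<^sub>R 2) = x + y"
  unfolding vec_eq_iff vector_add_component midpoint_nth using Ints_midpoint(1)[OF assms] by blast

text \<open>Among all representations of \<open>x0\<close> with objective at most \<open>\<eta>\<close>, one of least second moment has
  its support in a unit cube, because replacing a far pair by its rounded midpoints decreases it.\<close>

lemma convex_hull_epi_on_local_finite:
  fixes Y :: "(real ^ 'n::finite) set"
  assumes f: "L_natural_convex_on Y f" and Y: "midpoint_closed Y" "finite Y"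
    and \<eta>: "(\<eta>, x0) \<in> convex hull (epi_on Y f)"
  shows "(\<eta>, x0) \<in> convex hull (epi_on {x \<in> Y. \<forall>i. \<bar>x $ i - x0 $ i\<bar> \<le> 1} f)"
proof -
  \<comment> \<open>The middle coordinate records the second moment of a representation, so that
    minimising it means minimising a coordinate over a compact set. The last coordinate makes
    \<open>P\<close> injective.\<close>
  define P where "P x = (f x, x \<bullet> x, x)" for x
  define K where "K = convex hull (P ` Y)"
  have cK: "compact K" unfolding K_def by (intro finite_imp_compact_convex_hull finite_imageI Y)
  have vK: "convex K" unfolding K_def by simp
  have repr: "\<exists>\<mu>. (\<forall>x\<in>Y. 0 \<le> \<mu> x) \<and> sum \<mu> Y = 1 \<and> z = (\<Sum>x\<in>Y. \<mu> x *\<^sub>R P x)" if z: "z \<in> K" for z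
  proof -
    have inj: "inj_on P Y" by (auto simp: inj_on_def P_def)
    obtain \<mu> where \<mu>: "\<forall>z\<in>P ` Y. 0 \<le> \<mu> z" "sum \<mu> (P ` Y) = 1" "(\<Sum>z\<in>P ` Y. \<mu> z *\<^sub>R z) = z"
      using z unfolding K_def convex_hull_finite[OF finite_imageI[OF Y(2)]] mem_Collect_eq
      by blast
    then have "\<forall>x\<in>Y. 0 \<le> \<mu> (P x)" "(\<Sum>x\<in>Y. \<mu> (P x)) = 1" "z = (\<Sum>x\<in>Y. \<mu> (P x) *\<^sub>R P x)"
      by (simp_all only: sum.reindex[OF inj] o_def ball_simps)
    then show ?thesis by (intro exI[of _ "\<lambda>x. \<mu> (P x)"] conjI)
  qed
  have Kx: "\<exists>a b. a \<le> \<eta> \<and> (a, b, x0) \<in> K"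
  proof -
    have "convex hull (epi_on Y f) \<subseteq> {(\<eta>, x). \<exists>a b. a \<le> \<eta> \<and> (a, b, x) \<in> K}"
    proof (rule hull_minimal)
      show "epi_on Y f \<subseteq> {(\<eta>, x). \<exists>a b. a \<le> \<eta> \<and> (a, b, x) \<in> K}"
        unfolding epi_on_def K_def by (auto simp: P_def intro!: exI hull_inc)
      show "convex {(\<eta>, x). \<exists>a b. a \<le> \<eta> \<and> (a, b, x) \<in> K}"
      proof (rule convexI)
        fix p p' and u v :: real
        assume p: "p \<in> {(\<eta>, x). \<exists>a b. a \<le> \<eta> \<and> (a, b, x) \<in> K}"
          "p' \<in> {(\<eta>, x). \<exists>a b. a \<le> \<eta> \<and> (a, b, x) \<in> K}" and uv: "0 \<le> u" "0 \<le> v" "u + v = 1"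
        obtain e x a b e' x' a' b' where *: "p = (e, x)" "a \<le> e" "(a, b, x) \<in> K"
          "p' = (e', x')" "a' \<le> e'" "(a', b', x') \<in> K" using p by auto
        have "u *\<^sub>R (a, b, x) + v *\<^sub>R (a', b', x') \<in> K"
          using * uv by (intro convexD[OF vK])
        moreover have "u * a + v * a' \<le> u * e + v * e'"
          using * uv by (intro add_mono mult_left_mono)
        ultimately show "u *\<^sub>R p + v *\<^sub>R p' \<in> {(\<eta>, x). \<exists>a b. a \<le> \<eta> \<and> (a, b, x) \<in> K}"
          unfolding * by auto
      qed
    qed
    then show ?thesis using \<eta> by auto
  qed
  define L where "L = K \<inter> {z. fst z \<le> \<eta> \<and> snd (snd z) = x0}"
  have "closed {z :: real \<times> real \<times> (real ^ 'n). fst z \<le> \<eta> \<and> snd (snd z) = x0}"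
    by (intro closed_Collect_conj closed_Collect_le closed_Collect_eq continuous_intros)
  then have "compact L" unfolding L_def by (rule compact_Int_closed[OF cK])
  moreover have "L \<noteq> {}" using Kx by (auto simp: L_def)
  moreover have "continuous_on L (\<lambda>z. fst (snd z))" by (intro continuous_intros)
  ultimately have "\<exists>z\<in>L. \<forall>z'\<in>L. fst (snd z) \<le> fst (snd z')" by (rule continuous_attains_inf)
  then obtain z where z: "z \<in> L" and zmin: "\<And>z'. z' \<in> L \<Longrightarrow> fst (snd z) \<le> fst (snd z')" by metis
  obtain \<mu> where \<mu>: "\<And>x. x \<in> Y \<Longrightarrow> 0 \<le> \<mu> x" "sum \<mu> Y = 1" "z = (\<Sum>x\<in>Y. \<mu> x *\<^sub>R P x)"
    using repr[of z] z by (auto simp: L_def)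
  have int: "x $ i \<in> \<int>" if "x \<in> Y" for x i using Y that by (auto simp: midpoint_closed_def)
  have near: "\<bar>x $ k - y $ k\<bar> \<le> 1" if xy: "x \<in> Y" "y \<in> Y" "0 < \<mu> x" "0 < \<mu> y" for x y k
  proof (rule ccontr)
    assume far: "\<not> \<bar>x $ k - y $ k\<bar> \<le> 1"
    then have "x \<noteq> y" by auto
    define p q where "p = vec_ceiling ((x + y) /\<^sub>R 2)" and "q = vec_floor ((x + y) /\<^sub>R 2)"
    have pq: "p \<in> Y" "q \<in> Y" using Y(1) xy by (auto simp: midpoint_closed_def p_def q_def)
    define e where "e = min (\<mu> x) (\<mu> y)"
    have e: "0 < e" "e \<le> \<mu> x" "e \<le> \<mu> y" using xy by (auto simp: e_def)
    \<comment> \<open>Mass \<open>e\<close> will move from \<open>x\<close> and \<open>y\<close> to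
      \<open>p\<close> and \<open>q\<close>. With a separate function for each point, coincidences
      such as \<open>p = q\<close> need no case distinction.\<close>
    define I where "I a w = (if w = a then e else 0)" for a w :: "real ^ 'n"
    have I: "(\<Sum>w\<in>Y. I a w) = e" "(\<Sum>w\<in>Y. I a w *\<^sub>R P w) = e *\<^sub>R P a" if "a \<in> Y" for a
      using that Y(2) by (simp_all add: I_def if_distrib[of "\<lambda>c. c *\<^sub>R _"] cong: if_cong)
    define \<nu> where "\<nu> w = \<mu> w - I x w - I y w + I p w + I q w" for w
    have \<nu>0: "0 \<le> \<nu> w" if "w \<in> Y" for w
    proof -
      have "I x w + I y w \<le> \<mu> w" using \<mu>(1)[OF that] e \<open>x \<noteq> y\<close> by (auto simp: I_def)
      moreover have "0 \<le> I p w" "0 \<le> I q w" using e by (auto simp: I_def)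
      ultimately show ?thesis by (simp add: \<nu>_def)
    qed
    have \<nu>1: "sum \<nu> Y = 1"
      by (simp add: \<nu>_def sum.distrib sum_subtractf I xy pq \<mu>(2))
    define z' where "z' = (\<Sum>w\<in>Y. \<nu> w *\<^sub>R P w)"
    have z'_eq: "z' = z - e *\<^sub>R P x - e *\<^sub>R P y + e *\<^sub>R P p + e *\<^sub>R P q"
      by (simp add: z'_def \<nu>_def scaleR_add_left scaleR_diff_left sum.distrib sum_subtractf I xy pq \<mu>(3))
    have "z' \<in> K"
      unfolding z'_def by (intro convex_sum[OF Y(2) vK \<nu>1 \<nu>0]) (auto simp: K_def intro: hull_inc)
    moreover have "fst z' \<le> \<eta>"
    proof -
      have "fst z' = fst z - e * (f x + f y - (f p + f q))"
        unfolding z'_eq by (simp add: P_def algebra_simps)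
      moreover have "0 \<le> f x + f y - (f p + f q)"
        using L_natural_convex_onD[OF f xy(1,2)] by (simp add: p_def q_def)
      then have "0 \<le> e * (f x + f y - (f p + f q))" using e(1) by simp
      ultimately show ?thesis using z unfolding L_def by auto
    qed
    moreover have "snd (snd z') = x0"
    proof -
      have "snd (snd z') = snd (snd z) + e *\<^sub>R ((p + q) - (x + y))"
        unfolding z'_eq by (simp add: P_def algebra_simps)
      also have "p + q = x + y" unfolding p_def q_def using midpoint_add int xy by blast
      finally show ?thesis using z by (simp add: L_def)
    qed
    ultimately have "fst (snd z) \<le> fst (snd z')" using zmin by (simp add: L_def)
    moreover have "fst (snd z') = fst (snd z) - e * (x \<bullet> x + y \<bullet> y - (p \<bullet> p + q \<bullet> q))"
      unfolding z'_eq by (simp add: P_def algebra_simps)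
    moreover have "p \<bullet> p + q \<bullet> q < x \<bullet> x + y \<bullet> y"
      unfolding p_def q_def using far int xy by (intro inner_midpoint_less[of x y k]) auto
    then have "0 < e * (x \<bullet> x + y \<bullet> y - (p \<bullet> p + q \<bullet> q))" using e(1) by simp
    ultimately show False by linarith
  qed
  have x0: "(\<Sum>x\<in>Y. \<mu> x *\<^sub>R x) = x0"
    using z \<mu>(3) by (simp add: L_def P_def snd_sum scaleR_prod_def)
  have x0_near: "\<bar>x $ i - x0 $ i\<bar> \<le> 1" if x: "x \<in> Y" "0 < \<mu> x" for x i
  proof -
    \<comment> \<open>The difference to the barycentre is a weighted mean of the differences to the
      support points, which \<open>near\<close> bounds by one.\<close>
    have "x $ i - x0 $ i = (\<Sum>y\<in>Y. \<mu> y * (x $ i - y $ i))"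
      by (simp add: x0[symmetric] right_diff_distrib sum_subtractf sum_distrib_right[symmetric] \<mu>(2))
    also have "\<bar>\<dots>\<bar> \<le> (\<Sum>y\<in>Y. \<bar>\<mu> y * (x $ i - y $ i)\<bar>)" by (rule sum_abs)
    also have "\<dots> \<le> (\<Sum>y\<in>Y. \<mu> y)"
    proof (rule sum_mono)
      fix y assume y: "y \<in> Y"
      show "\<bar>\<mu> y * (x $ i - y $ i)\<bar> \<le> \<mu> y"
      proof (cases "\<mu> y = 0")
        case False
        then have "0 < \<mu> y" using \<mu>(1)[OF y] by simp
        then show ?thesis using near[OF x(1) y x(2), of i] by (simp add: abs_mult)
      qed simp
    qed
    finally show ?thesis using \<mu>(2) by simp
  qed
  define Z where "Z = {x \<in> Y. \<forall>i. \<bar>x $ i - x0 $ i\<bar> \<le> 1}"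
  have sums: "sum g Z = sum g Y" if "\<And>x. x \<in> Y \<Longrightarrow> \<mu> x = 0 \<Longrightarrow> g x = 0" for g :: "_ \<Rightarrow> 'b::comm_monoid_add"
    using Y(2) x0_near \<mu>(1) that unfolding Z_def
    by (intro sum.mono_neutral_left) (auto simp: less_le)
  have "fst z = (\<Sum>x\<in>Y. \<mu> x * f x)"
    using \<mu>(3) by (simp add: P_def fst_sum scaleR_prod_def)
  then have fz: "(\<Sum>x\<in>Y. \<mu> x * f x) \<le> \<eta>" using z by (simp add: L_def)
  \<comment> \<open>The slack: added to every value, it lifts the weighted mean exactly to
    \<open>\<eta>\<close>, because the weights sum to one.\<close>
  define d where "d = \<eta> - (\<Sum>x\<in>Y. \<mu> x * f x)"
  have "(\<Sum>x\<in>Z. \<mu> x *\<^sub>R (f x + d, x)) \<in> convex hull (epi_on Z f)"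
  proof (intro convex_sum convex_convex_hull)
    show "finite Z" using Y by (simp add: Z_def)
    show "sum \<mu> Z = 1" using sums[of \<mu>] \<mu>(2) by simp
    show "0 \<le> \<mu> x" if "x \<in> Z" for x using that \<mu>(1) by (simp add: Z_def)
    show "(f x + d, x) \<in> convex hull (epi_on Z f)" if "x \<in> Z" for x
      using that fz by (intro hull_inc) (simp add: epi_on_def d_def)
  qed
  also have "(\<Sum>x\<in>Z. \<mu> x *\<^sub>R (f x + d, x)) = (\<Sum>x\<in>Y. \<mu> x *\<^sub>R (f x + d, x))"
    by (rule sums) (simp add: zero_prod_def)
  also have "\<dots> = (\<eta>, x0)"
    by (simp add: prod_eq_iff fst_sum snd_sum x0 distrib_left sum.distrib sum_distrib_right[symmetric] \<mu>(2) d_def)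
  finally show ?thesis unfolding Z_def .
qed

text \<open>A convex combination involves finitely many points, so the hull is the increasing union
  of the hulls over the sets \<open>Y M\<close>, which are finite as bounded sets of integer
  points.\<close>

lemma convex_hull_epi_on_local:
  fixes X :: "(real ^ 'n::finite) set"
  assumes f: "L_natural_convex_on X f" and X: "midpoint_closed X"
    and \<eta>: "(\<eta>, x0) \<in> convex hull (epi_on X f)"
  shows "(\<eta>, x0) \<in> convex hull (epi_on {x \<in> X. \<forall>i. \<bar>x $ i - x0 $ i\<bar> \<le> 1} f)"
proof -
  define Y where "Y M = {x \<in> X. \<forall>i. \<bar>x $ i\<bar> \<le> M}" for M
  have mono: "convex hull (epi_on (Y M) f) \<subseteq> convex hull (epi_on (Y M') f)" if "M \<le> M'" for M M'
    using that by (intro hull_mono) (auto simp: Y_def epi_on_def intro: order_trans)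
  have "convex hull (epi_on X f) \<subseteq> (\<Union>M. convex hull (epi_on (Y M) f))"
  proof (rule hull_minimal)
    show "epi_on X f \<subseteq> (\<Union>M. convex hull (epi_on (Y M) f))"
    proof
      fix z assume z: "z \<in> epi_on X f"
      then have "z \<in> epi_on (Y (norm (snd z))) f"
        by (auto simp: epi_on_def Y_def component_le_norm_cart)
      then show "z \<in> (\<Union>M. convex hull (epi_on (Y M) f))" by (blast intro: hull_inc)
    qed
    show "convex (\<Union>M. convex hull (epi_on (Y M) f))"
    proof (rule convexI)
      fix a b and u v :: real
      assume ab: "a \<in> (\<Union>M. convex hull (epi_on (Y M) f))" "b \<in> (\<Union>M. convex hull (epi_on (Y M) f))"
        and uv: "0 \<le> u" "0 \<le> v" "u + v = 1"
      from ab obtain M M' where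
        "a \<in> convex hull (epi_on (Y M) f)" "b \<in> convex hull (epi_on (Y M') f)" by blast
      then have "a \<in> convex hull (epi_on (Y (max M M')) f)" "b \<in> convex hull (epi_on (Y (max M M')) f)"
        using mono[of M "max M M'"] mono[of M' "max M M'"] by auto
      then have "u *\<^sub>R a + v *\<^sub>R b \<in> convex hull (epi_on (Y (max M M')) f)"
        using uv by (intro convexD[OF convex_convex_hull])
      then show "u *\<^sub>R a + v *\<^sub>R b \<in> (\<Union>M. convex hull (epi_on (Y M) f))" by blast
    qed
  qed
  then obtain M where M: "(\<eta>, x0) \<in> convex hull (epi_on (Y M) f)" using \<eta> by blast
  have mc: "midpoint_closed (Y M)" unfolding Y_def by (rule midpoint_closed_Int_box[OF X])
  have fin: "finite (Y M)"
    by (rule finite_bounded_Ints_vec[of _ M]) (use X in \<open>auto simp: Y_def midpoint_closed_def\<close>)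
  have "L_natural_convex_on (Y M) f" using f by (auto simp: L_natural_convex_on_def Y_def)
  from convex_hull_epi_on_local_finite[OF this mc fin M]
  have "(\<eta>, x0) \<in> convex hull (epi_on {x \<in> Y M. \<forall>i. \<bar>x $ i - x0 $ i\<bar> \<le> 1} f)" .
  then show ?thesis
    by (rule subsetD[OF hull_mono, rotated]) (auto simp: Y_def epi_on_def)
qed

section \<open>From the hull of \<open>epi_H\<close> to the hulls of the epigraphs of
  \<open>F_fun\<close>\<close>

text \<open>The constraints \<open>h i x \<le> w + y $ i\<close>, combined with weights
  \<open>v\<close> that attain \<open>F_fun\<close>, give the bound with \<open>v\<close> in place
  of \<open>u\<close>; as \<open>y\<close> is nonnegative, \<open>v\<close> may be raised to
  \<open>u\<close>.\<close>

lemma F_fun_le_epi_H: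
  fixes h :: "'n::finite \<Rightarrow> real ^ 'n \<Rightarrow> real"
  assumes "(u0, u) \<in> multipliers" "(w, y, x) \<in> epi_H X h"
  shows "F_fun h u0 u x \<le> u0 * w + u \<bullet> y"
proof -
  have y: "\<And>i. 0 \<le> y $ i" and w: "\<And>i. h i x - y $ i \<le> w"
    using assms(2) by (auto simp: epi_H_def)
  obtain v where v: "\<And>i. 0 \<le> v i" "\<And>i. v i \<le> u $ i" "sum v UNIV = u0"
    "F_fun h u0 u x = (\<Sum>i\<in>UNIV. v i * h i x)"
    by (rule F_fun_weights[OF assms(1), where h = h and x = x], rule that)
  have "h i x \<le> w + y $ i" for i using w[of i] by linarith
  then have "F_fun h u0 u x \<le> (\<Sum>i\<in>UNIV. v i * (w + y $ i))"
    unfolding v(4) by (intro sum_mono mult_left_mono v)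
  also have "\<dots> = u0 * w + (\<Sum>i\<in>UNIV. v i * y $ i)"
    by (simp add: distrib_left sum.distrib sum_distrib_right[symmetric] v(3))
  also have "\<dots> \<le> u0 * w + u \<bullet> y"
    unfolding inner_vec_def inner_real_def by (intro add_left_mono sum_mono mult_right_mono v y)
  finally show ?thesis .
qed

text \<open>The preimage of a hull under the linear map \<open>A\<close> is convex, so it is enough
  to check the points of \<open>epi_H X h\<close>.\<close>

lemma convex_hull_epi_H_imp:
  fixes h :: "'n::finite \<Rightarrow> real ^ 'n \<Rightarrow> real"
  assumes "(u0, u) \<in> multipliers" "(w, y, x) \<in> convex hull (epi_H X h)"
  shows "(u0 * w + u \<bullet> y, x) \<in> convex hull (epi_on X (F_fun h u0 u))"
proof -
  define A where "A = (\<lambda>(w, y, x). (u0 * w + u \<bullet> y, x) :: real \<times> (real ^ 'n))"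
  have lin: "linear A"
    by (rule linearI) (auto simp: A_def algebra_simps)
  have "convex hull (epi_H X h) \<subseteq> A -` (convex hull (epi_on X (F_fun h u0 u)))"
  proof (rule hull_minimal)
    show "epi_H X h \<subseteq> A -` (convex hull (epi_on X (F_fun h u0 u)))"
    proof
      fix z assume z: "z \<in> epi_H X h"
      obtain w y x where [simp]: "z = (w, y, x)" by (cases z)
      have "x \<in> X" using z by (auto simp: epi_H_def)
      then have "A z \<in> epi_on X (F_fun h u0 u)"
        using F_fun_le_epi_H[OF assms(1)] z by (simp add: A_def epi_on_def)
      then show "z \<in> A -` (convex hull (epi_on X (F_fun h u0 u)))" by (simp add: hull_inc)
    qed
    show "convex (A -` (convex hull (epi_on X (F_fun h u0 u))))"
      by (intro convex_linear_vimage[OF lin] convex_convex_hull)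
  qed
  then show ?thesis using assms(2) by (auto simp: A_def)
qed

section \<open>Recession cone and separation over a finite domain\<close>

text \<open>The directions that can be added to \<open>(w, y)\<close> without leaving
  \<open>epi_H\<close>, whatever \<open>h\<close> and \<open>x\<close> are.\<close>

definition rec_cone_H :: "(real \<times> (real ^ 'n::finite)) set" where
  "rec_cone_H = {(a, b). \<forall>i. 0 \<le> b $ i \<and> 0 \<le> a + b $ i}"

lemma convex_rec_cone_H: "convex (rec_cone_H :: (real \<times> (real ^ 'n::finite)) set)"
proof (rule convexI)
  fix p q :: "real \<times> (real ^ 'n)" and u v :: real
  assume pq: "p \<in> rec_cone_H" "q \<in> rec_cone_H" and uv: "0 \<le> u" "0 \<le> v" "u + v = 1"
  have "0 \<le> u * snd p $ i + v * snd q $ i" "0 \<le> u * (fst p + snd p $ i) + v * (fst q + snd q $ i)" for i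
    using pq uv by (auto simp: rec_cone_H_def case_prod_beta intro!: add_nonneg_nonneg mult_nonneg_nonneg)
  then show "u *\<^sub>R p + v *\<^sub>R q \<in> rec_cone_H"
    by (simp add: rec_cone_H_def case_prod_beta algebra_simps)
qed

lemma closed_rec_cone_H: "closed (rec_cone_H :: (real \<times> (real ^ 'n::finite)) set)"
  unfolding rec_cone_H_def case_prod_beta
  by (intro closed_Collect_all closed_Collect_conj closed_Collect_le continuous_intros)

lemma rec_cone_H_scale:
  assumes "z \<in> rec_cone_H" "0 \<le> t"
  shows "t *\<^sub>R z \<in> rec_cone_H"
  using assms by (auto simp: rec_cone_H_def case_prod_beta distrib_left[symmetric])

text \<open>Three kinds of directions suffice: \<open>(1, 0)\<close> tests the sign of
  \<open>u0\<close>, the axes test the signs of \<open>u\<close>, and \<open>(-1, 1)\<close> tests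
  that \<open>u0\<close> is at most the sum of the entries of \<open>u\<close>.\<close>

lemma dual_rec_cone_H:
  fixes u :: "real ^ 'n::finite"
  assumes "\<forall>z\<in>rec_cone_H. 0 \<le> (u0, u) \<bullet> z"
  shows "(u0, u) \<in> multipliers"
proof -
  have "(1, 0) \<in> rec_cone_H" "(-1, 1) \<in> rec_cone_H" "(0, axis i 1) \<in> rec_cone_H" for i :: 'n
    by (simp_all add: rec_cone_H_def axis_def)
  from this[THEN bspec[OF assms]] show ?thesis
    by (simp add: multipliers_def inner_axis inner_vec_def[of u 1])
qed

text \<open>Translation by \<open>(a, b, 0)\<close> maps \<open>epi_H X h\<close> into itself and
  commutes with the convex hull.\<close>

lemma convex_hull_epi_H_add_rec_cone:
  fixes h :: "'n::finite \<Rightarrow> real ^ 'n \<Rightarrow> real"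
  assumes "(w, y, x) \<in> convex hull (epi_H X h)" "(a, b) \<in> rec_cone_H"
  shows "(w + a, y + b, x) \<in> convex hull (epi_H X h)"
proof -
  have "(+) (a, b, 0) ` epi_H X h \<subseteq> epi_H X h"
  proof (rule image_subsetI)
    fix z assume "z \<in> epi_H X h"
    then obtain w y x where z_eq: "z = (w, y, x)" and z: "(w, y, x) \<in> epi_H X h" by (cases z) auto
    have "0 \<le> b $ i + y $ i" "h i x - (b $ i + y $ i) \<le> a + w" for i
      using z assms(2) by (auto simp: epi_H_def rec_cone_H_def intro: add_nonneg_nonneg
        dest!: spec[of _ i])
    then show "(a, b, 0) + z \<in> epi_H X h"
      using z unfolding z_eq by (simp add: epi_H_def)
  qed
  then have "convex hull ((+) (a, b, 0) ` epi_H X h) \<subseteq> convex hull (epi_H X h)"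
    by (rule hull_mono)
  moreover have "(w + a, y + b, x) \<in> (+) (a, b, 0) ` (convex hull (epi_H X h))"
    using assms(1) by (intro image_eqI[of _ _ "(w, y, x)"]) auto
  ultimately show ?thesis unfolding convex_hull_translation by blast
qed

text \<open>On a finite domain the hull is a polytope plus the recession cone, so each of its slices
  \<open>x = x0\<close> is closed and can be separated from a point by a multiplier in the dual cone.\<close>

lemma convex_hull_epi_H_finite:
  fixes h :: "'n::finite \<Rightarrow> real ^ 'n \<Rightarrow> real"
  assumes Y: "finite Y"
    and F: "\<And>u0 u. (u0, u) \<in> multipliers \<Longrightarrow>
      (u0 * w + u \<bullet> y, x) \<in> convex hull (epi_on Y (F_fun h u0 u))"
  shows "(w, y, x) \<in> convex hull (epi_H Y h)"
proof -
  \<comment> \<open>\<open>q j p\<close> is the point of the epigraph above \<open>p\<close> with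
    \<open>w = h j p\<close> and least \<open>y\<close>; the objective \<open>(u0, u)\<close> takes
    there the value of the \<open>j\<close>-th term of \<open>F_fun h u0 u p\<close>.\<close>
  define q where "q j p = (h j p, (\<chi> i. g_fun h j i p), p)" for j p
  define Q where "Q = convex hull ((\<lambda>(j, p). q j p) ` (UNIV \<times> Y))"
  define S where "S = {z. (fst z, snd z, x) \<in> Q}"
  define T where "T = (\<Union>z\<in>S. \<Union>c\<in>rec_cone_H. {z + c})"
  have cQ: "compact Q" "convex Q"
    unfolding Q_def using Y by (auto intro!: finite_imp_compact_convex_hull)
  have "S = (\<lambda>z. (fst z, fst (snd z))) ` (Q \<inter> {z. snd (snd z) = x})"
    by (force simp: S_def image_iff)
  moreover have "compact (Q \<inter> {z. snd (snd z) = x})"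
    by (intro compact_Int_closed cQ closed_Collect_eq continuous_intros)
  ultimately have "compact S"
    by (auto intro!: compact_continuous_image continuous_intros)
  then have "closed T" unfolding T_def by (intro compact_closed_sums closed_rec_cone_H)
  have "convex S"
  proof (rule convexI)
    fix a b and u v :: real
    assume ab: "a \<in> S" "b \<in> S" and uv: "0 \<le> u" "0 \<le> v" "u + v = 1"
    have "u *\<^sub>R (fst a, snd a, x) + v *\<^sub>R (fst b, snd b, x) \<in> Q"
      using ab uv by (intro convexD[OF cQ(2)]) (auto simp: S_def)
    then show "u *\<^sub>R a + v *\<^sub>R b \<in> S"
      using uv by (simp add: S_def scaleR_add_left[symmetric])
  qed
  then have "convex T" unfolding T_def by (intro convex_sums convex_rec_cone_H)
  have S_ex: "\<exists>z\<in>S. (u0, u) \<bullet> z \<le> u0 * w + u \<bullet> y" if u: "(u0, u) \<in> multipliers" for u0 u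
  proof -
    \<comment> \<open>The image of \<open>Q\<close> under the objective, extended upwards. It is
      convex and contains the epigraph of \<open>F_fun\<close>, so \<open>F\<close> yields a point
      of \<open>Q\<close> above \<open>x\<close> with small objective.\<close>
    define V where "V = {(\<eta>, p). \<exists>a b. (a, b, p) \<in> Q \<and> u0 * a + u \<bullet> b \<le> \<eta>}"
    have "convex hull (epi_on Y (F_fun h u0 u)) \<subseteq> V"
    proof (rule hull_minimal)
      show "epi_on Y (F_fun h u0 u) \<subseteq> V"
      proof clarify
        fix \<eta> p assume p: "(\<eta>, p) \<in> epi_on Y (F_fun h u0 u)"
        obtain j where j: "F_fun h u0 u p = u0 * h j p + (\<Sum>i\<in>UNIV. u $ i * g_fun h j i p)"
          by (rule F_fun_attained)
        have "q j p \<in> Q" unfolding Q_def using p by (intro hull_inc) (auto simp: epi_on_def)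
        then show "(\<eta>, p) \<in> V"
          using p j by (auto simp: V_def q_def epi_on_def inner_vec_def intro!: exI)
      qed
      show "convex V"
      proof (rule convexI)
        fix r s and k l :: real
        assume rs: "r \<in> V" "s \<in> V" and kl: "0 \<le> k" "0 \<le> l" "k + l = 1"
        obtain e p a b e' p' a' b' where *: "r = (e, p)" "(a, b, p) \<in> Q" "u0 * a + u \<bullet> b \<le> e"
          "s = (e', p')" "(a', b', p') \<in> Q" "u0 * a' + u \<bullet> b' \<le> e'" using rs by (auto simp: V_def)
        have "k *\<^sub>R (a, b, p) + l *\<^sub>R (a', b', p') \<in> Q"
          using * kl by (intro convexD[OF cQ(2)])
        moreover have "k * (u0 * a + u \<bullet> b) + l * (u0 * a' + u \<bullet> b') \<le> k * e + l * e'"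
          using * kl by (intro add_mono mult_left_mono)
        ultimately show "k *\<^sub>R r + l *\<^sub>R s \<in> V"
          unfolding * V_def
          by (auto simp: inner_add_right algebra_simps
              intro!: exI[of _ "k * a + l * a'"] exI[of _ "k *\<^sub>R b + l *\<^sub>R b'"])
      qed
    qed
    then obtain a b where "(a, b, x) \<in> Q" "u0 * a + u \<bullet> b \<le> u0 * w + u \<bullet> y"
      using F[OF u] by (auto simp: V_def)
    then show ?thesis by (intro bexI[of _ "(a, b)"]) (auto simp: S_def)
  qed
  have "(w, y) \<in> T"
  proof (rule ccontr)
    assume "(w, y) \<notin> T"
    then obtain d \<beta> where d: "d \<bullet> (w, y) < \<beta>" "\<And>z. z \<in> T \<Longrightarrow> \<beta> < d \<bullet> z"
      using separating_hyperplane_closed_point[OF \<open>convex T\<close> \<open>closed T\<close>] by blast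
    obtain u0 u where du: "d = (u0, u)" by (cases d)
    \<comment> \<open>For the zero multiplier \<open>F\<close> says that \<open>x\<close> lies in
      the hull of \<open>Y\<close>; this makes the slice \<open>S\<close> nonempty.\<close>
    have "(0, 0) \<in> multipliers" by (simp add: multipliers_def)
    then obtain z0 where z0: "z0 \<in> S" using S_ex by blast
    have "0 \<le> (u0, u) \<bullet> c" if c: "c \<in> rec_cone_H" for c
    proof (rule ccontr, fold du)
      assume neg: "\<not> 0 \<le> d \<bullet> c"
      \<comment> \<open>Large enough to bring \<open>d \<bullet> (z0 + t *\<^sub>R c)\<close> down
        to at most \<open>\<beta>\<close>, against \<open>d(2)\<close>; the maximum with
        \<open>0\<close> keeps the step inside the cone.\<close>
      define t where "t = max 0 ((\<beta> - d \<bullet> z0) / (d \<bullet> c))"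
      have "(\<beta> - d \<bullet> z0) / (d \<bullet> c) \<le> t" by (simp add: t_def)
      then have "t * (d \<bullet> c) \<le> \<beta> - d \<bullet> z0"
        using neg by (simp add: divide_le_eq)
      moreover have "z0 + t *\<^sub>R c \<in> T"
        using z0 rec_cone_H_scale[OF c, of t] by (auto simp: T_def t_def)
      ultimately show False using d(2)[of "z0 + t *\<^sub>R c"] by (simp add: inner_add_right)
    qed
    then have "(u0, u) \<in> multipliers" by (intro dual_rec_cone_H ballI)
    then obtain z where z: "z \<in> S" "(u0, u) \<bullet> z \<le> u0 * w + u \<bullet> y" using S_ex by blast
    have "(0, 0) \<in> rec_cone_H" by (simp add: rec_cone_H_def)
    then have "z + (0, 0) \<in> T" unfolding T_def using z(1) by blast
    then have "z \<in> T" by (simp flip: zero_prod_def)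
    then show False using d(1) d(2)[of z] z(2) by (simp add: du)
  qed
  then obtain w' y' a b where *: "(w', y', x) \<in> Q" "(a, b) \<in> rec_cone_H" "w = w' + a" "y = y' + b"
    by (auto simp: T_def S_def)
  have "Q \<subseteq> convex hull (epi_H Y h)"
    unfolding Q_def by (rule hull_mono) (auto simp: q_def epi_H_def g_fun_def)
  then show ?thesis using convex_hull_epi_H_add_rec_cone[OF _ *(2)] * by auto
qed

section \<open>The two inclusions over a discrete hyperrectangle\<close>

lemma convex_relaxed_hyperrectangle:
  fixes lb ub :: "'n::finite \<Rightarrow> ereal"
  shows "convex (relaxed_hyperrectangle lb ub)"
proof -
  have "relaxed_hyperrectangle lb ub =
      (\<Inter>i. (\<lambda>x. x $ i) -` {t. lb i \<le> ereal t \<and> ereal t \<le> ub i})"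
    by (auto simp: relaxed_hyperrectangle_def)
  moreover have "convex {t. lb i \<le> ereal t \<and> ereal t \<le> ub i}" for i
    unfolding is_interval_convex_1[symmetric] is_interval_1
    by (auto intro: order_trans[of "lb i"] order_trans[where z = "ub i"] simp del: ereal_less_eq simp flip: ereal_less_eq(3))
  moreover have "linear (\<lambda>x :: real ^ 'n. x $ i)" for i by (rule linearI) auto
  ultimately show ?thesis
    by (simp only:) (intro convex_INT convex_linear_vimage)
qed

theorem theorem5p11:
  fixes lb ub :: "'n::finite \<Rightarrow> ereal"
    and X :: "(real ^ 'n) set"
    and h :: "'n \<Rightarrow> real ^ 'n \<Rightarrow> real"
  assumes "hyperrectangle_bounds lb ub"
    and "X = discrete_hyperrectangle lb ub"
    and "\<And>j. L_natural_convex_on X (h j)"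
    and "\<And>i j. L_natural_convex_on X (g_fun h j i)"
  shows "convex hull (epi_H X h) =
    {(w, y, x). x \<in> relaxed_hyperrectangle lb ub \<and>
       (\<forall>(u0, u) \<in> multipliers. (u0 * w + u \<bullet> y, x) \<in> convex hull (epi_on X (F_fun h u0 u)))}"
    (is "_ = ?R")
proof (intro set_eqI iffI)
  fix z assume z: "z \<in> convex hull (epi_H X h)"
  have "convex hull (epi_H X h) \<subseteq> UNIV \<times> UNIV \<times> relaxed_hyperrectangle lb ub"
    by (intro hull_minimal convex_Times convex_relaxed_hyperrectangle convex_UNIV)
      (auto simp: epi_H_def assms(2) discrete_hyperrectangle_def relaxed_hyperrectangle_def)
  then show "z \<in> ?R" using z convex_hull_epi_H_imp by (auto split: prod.splits)
next
  fix z assume z: "z \<in> ?R"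
  obtain w y x where z_eq: "z = (w, y, x)" by (cases z)
  \<comment> \<open>\<open>Y\<close> is fixed before any multiplier is chosen: the separation needs
    one finite set that serves all of them.\<close>
  define Y where "Y = {p \<in> X. \<forall>i. \<bar>p $ i - x $ i\<bar> \<le> 1}"
  have X: "midpoint_closed X"
    unfolding assms(2) by (rule midpoint_closed_discrete_hyperrectangle)
  have "finite Y"
  proof (rule finite_bounded_Ints_vec)
    fix p i assume p: "p \<in> Y"
    show "p $ i \<in> \<int>" using p X by (auto simp: Y_def midpoint_closed_def)
    have "\<bar>p $ i - x $ i\<bar> \<le> 1" using p by (auto simp: Y_def)
    then show "\<bar>p $ i\<bar> \<le> 1 + norm x" using component_le_norm_cart[of x i] by linarith
  qed
  moreover have "(u0 * w + u \<bullet> y, x) \<in> convex hull (epi_on Y (F_fun h u0 u))"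
    if u: "(u0, u) \<in> multipliers" for u0 u
    unfolding Y_def
    using z u by (intro convex_hull_epi_on_local L_natural_convex_on_F_fun assms(3,4) X) (auto simp: z_eq)
  ultimately have "(w, y, x) \<in> convex hull (epi_H Y h)" by (rule convex_hull_epi_H_finite)
  moreover have "convex hull (epi_H Y h) \<subseteq> convex hull (epi_H X h)"
    by (intro hull_mono) (auto simp: Y_def epi_H_def)
  ultimately show "z \<in> convex hull (epi_H X h)" by (auto simp: z_eq)
qed

end
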